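(* Let $X\in S_n$, $G\in\mathbb{S}^n$ and $d>0$. Then the matrix $$Y^*=\mathcal H(X,G,d,r_d(X))$$ is an optimal solution of the problem $$\min\{\langle Y,G\rangle \ :\ Y\in S_n\cap S(X,d)\}.$$
   Context: $\mathbb{S}^n$ is the space of real symmetric $n\times n$ matrices with the trace inner product $\langle\cdot,\cdot\rangle$. $S_n=\{X\in\mathbb{S}^n : \operatorname{tr}(X)=1,\ X\succeq0\}$, $\Delta_n=\{x\in\mathbb{R}^n: x_i\ge0,\ \sum_i x_i=1\}$, $\mathcal O_n$ is the orthogonal group, $[n]=\{1,\dots,n\}$, $\mathbf 1_n$ the all-ones vector. For $A\in\mathbb{S}^n$, $\lambda_1(A)\ge\dots\ge\lambda_n(A)$ are its eigenvalues and $\boldsymbol\lambda(A)=(\lambda_1(A),\dots,\lambda_n(A))^T$. Simplex ball: $\Delta(x,d):=\{x-d\mathbf 1_n+nd\,\boldsymbol\lambda : \boldsymbol\lambda\in\Delta_n\}$ for $x\in\mathbb{R}^n$, $d>0$. Spectral ball: $S(X,d):=\{Q\operatorname{diag}(\boldsymbol\lambda)Q^T : Q\in\mathcal O_n,\ \boldsymbol\lambda\in\Delta(\boldsymbol\lambda(X),d)\}$ for $X\in S_n$, $d>0$. Thresholding rank: $r_d(X):=\max\{i\in[n] : \lambda_i(X)>d\}$, with the convention $\max\emptyset=0$. Thresholding mapping: for $X,G\in\mathbb{S}^n$, $d>0$ and an integer $0\le r\le n$, $$\mathcal H(X,G,d,r):=V(\Lambda_r-dI_r)V^T+n\widehat d\,v_nv_n^T,$$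 where $\Lambda_r=\operatorname{diag}\{\lambda_1(X),\dots,\lambda_r(X)\}$, $\widehat d=\frac1n\big(1+rd-\sum_{i=1}^r\lambda_i(X)\big)$, and $V=[v_n,v_{n-1},\dots,v_{n-r+1}]\in\mathbb{R}^{n\times r}$, where $v_1,\dots,v_n$ is an orthonormal basis of eigenvectors of $G$ with $Gv_i=\lambda_i(G)v_i$ (any such choice). So the columns of $V$ are eigenvectors for the $r$ smallest eigenvalues of $G$, ordered from the smallest eigenvalue upward. For $r=0$ the first term is zero and $\mathcal H(X,G,d,0)=v_nv_n^T$. *)

theory Defs
  imports
    "Jordan_Normal_Form.Char_Poly"
    "HOL-Library.Multiset"
begin

definition mat_trace :: "real mat \<Rightarrow> real" where
  "mat_trace A = (\<Sum>i<dim_row A. A $$ (i, i))"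

definition trace_inner :: "real mat \<Rightarrow> real mat \<Rightarrow> real" where
  "trace_inner A B = mat_trace (A\<^sup>T * B)"

definition sym_mats :: "nat \<Rightarrow> real mat set" where
  "sym_mats n = {A \<in> carrier_mat n n. A\<^sup>T = A}"

definition psd :: "nat \<Rightarrow> real mat \<Rightarrow> bool" where
  "psd n A \<longleftrightarrow> A \<in> sym_mats n \<and> (\<forall>x \<in> carrier_vec n. 0 \<le> x \<bullet> (A *\<^sub>v x))"

definition spectraplex :: "nat \<Rightarrow> real mat set" where
  "spectraplex n = {X \<in> sym_mats n. mat_trace X = 1 \<and> psd n X}"

definition simplex :: "nat \<Rightarrow> real vec set" where
  "simplex n = {x \<in> carrier_vec n. (\<forall>i<n. 0 \<le> x $ i) \<and> (\<Sum>i<n. x $ i) = 1}"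

definition orth_group :: "nat \<Rightarrow> real mat set" where
  "orth_group n = {Q \<in> carrier_mat n n. Q * Q\<^sup>T = 1\<^sub>m n}"

text \<open>The real eigenvalues, repeated according to algebraic multiplicity and in
  decreasing order. For a symmetric matrix of size \<open>n\<close> this list has length \<open>n\<close>.
  The indices of \<open>eigval\<close> below, as those of \<open>v\<close> in \<open>ordered_eigenbasis\<close>, run from 1 to \<open>n\<close>,
  whereas vector and matrix entries are indexed from 0.\<close>

definition eigvals :: "real mat \<Rightarrow> real list" where
  "eigvals A = rev (sorted_list_of_multiset (proots (char_poly A)))"

definition eigval :: "real mat \<Rightarrow> nat \<Rightarrow> real" where
  "eigval A i = eigvals A ! (i - 1)"

definition eigval_vec :: "real mat \<Rightarrow> real vec" where
  "eigval_vec A = vec_of_list (eigvals A)"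

definition simplex_ball :: "nat \<Rightarrow> real vec \<Rightarrow> real \<Rightarrow> real vec set" where
  "simplex_ball n x d =
     {x - d \<cdot>\<^sub>v vec n (\<lambda>_. 1) + (real n * d) \<cdot>\<^sub>v l | l. l \<in> simplex n}"

definition spectral_ball :: "nat \<Rightarrow> real mat \<Rightarrow> real \<Rightarrow> real mat set" where
  "spectral_ball n X d =
     {Q * mat_diag n (\<lambda>i. l $ i) * Q\<^sup>T | Q l.
        Q \<in> orth_group n \<and> l \<in> simplex_ball n (eigval_vec X) d}"

definition thresh_rank :: "nat \<Rightarrow> real mat \<Rightarrow> real \<Rightarrow> nat" where
  "thresh_rank n X d =
     (let I = {i \<in> {1..n}. eigval X i > d} in if I = {} then 0 else Max I)"

definition ordered_eigenbasis :: "nat \<Rightarrow> real mat \<Rightarrow> (nat \<Rightarrow> real vec) \<Rightarrow> bool" where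
  "ordered_eigenbasis n G v \<longleftrightarrow>
     (\<forall>i \<in> {1..n}. v i \<in> carrier_vec n \<and> G *\<^sub>v v i = eigval G i \<cdot>\<^sub>v v i) \<and>
     (\<forall>i \<in> {1..n}. \<forall>j \<in> {1..n}. v i \<bullet> v j = (if i = j then 1 else 0))"

definition thresh_shift :: "nat \<Rightarrow> real mat \<Rightarrow> real \<Rightarrow> nat \<Rightarrow> real" where
  "thresh_shift n X d r = 1 / real n * (1 + real r * d - (\<Sum>i=1..r. eigval X i))"

text \<open>The thresholding mapping depends on \<open>G\<close> only through the chosen eigenbasis \<open>v\<close> of \<open>G\<close>,
  which is therefore passed in place of \<open>G\<close>; statements quantify over all \<open>v\<close> with
  \<open>ordered_eigenbasis n G v\<close>.\<close>

definition thresh_map :: "nat \<Rightarrow> real mat \<Rightarrow> (nat \<Rightarrow> real vec) \<Rightarrow> real \<Rightarrow> nat \<Rightarrow> real mat" where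
  "thresh_map n X v d r =
     (let V = mat_of_cols n (map (\<lambda>k. v (n - k)) [0..<r]);
          vn = mat_of_cols n [v n]
      in V * (mat_diag r (\<lambda>k. eigval X (k + 1)) - d \<cdot>\<^sub>m 1\<^sub>m r) * V\<^sup>T
         + (real n * thresh_shift n X d r) \<cdot>\<^sub>m (vn * vn\<^sup>T))"

end

theory Submission
  imports Defs "Jordan_Normal_Form.Schur_Decomposition"
begin

text \<open>A feasible \<open>Y\<close> is \<open>Q diag(l) Q\<^sup>T\<close> with \<open>Q\<close> orthogonal, \<open>\<Sum> l\<^sub>i = 1\<close> and
  \<open>l\<^sub>i \<ge> m\<^sub>i := max (\<lambda>\<^sub>i(X) - d) 0\<close>. Writing \<open>G = U diag(g) U\<^sup>T\<close> with \<open>g\<close> increasing, \<open>\<langle>Y, G\<rangle>\<close> equals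
  \<open>\<Sum> l\<^sub>i g\<^sub>j D\<^sub>i\<^sub>j\<close>, where the squared entries \<open>D\<close> of \<open>Q\<^sup>T U\<close> form a doubly stochastic matrix.
  The mass \<open>m\<close>, which is decreasing, costs at least \<open>\<Sum> m\<^sub>i g\<^sub>i\<close> by rearrangement, and the excess
  mass \<open>1 - \<Sum> m\<^sub>i\<close> costs at least the smallest eigenvalue of \<open>G\<close> per unit. The thresholding
  mapping attains both bounds.\<close>

section \<open>Spectral theory of real symmetric matrices\<close>

lemma sym_mats_carrier: "A \<in> sym_mats n \<Longrightarrow> A \<in> carrier_mat n n"
  by (simp add: sym_mats_def)

text \<open>Moving the symmetric real matrix across the Hermitian product of an eigenvector
  \<open>u\<close> with itself replaces \<open>z\<close> by its conjugate, and
  \<open>u \<bullet>c u\<close> is nonzero.\<close>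

lemma sym_mats_eigenvalue_real:
  assumes A: "A \<in> sym_mats n" and ev: "eigenvalue (map_mat complex_of_real A) z"
  shows "z \<in> \<real>"
proof -
  let ?A = "map_mat complex_of_real A"
  have cA: "?A \<in> carrier_mat n n" using sym_mats_carrier[OF A] by simp
  have sA: "?A\<^sup>T = ?A" using A by (simp add: sym_mats_def map_mat_transpose)
  obtain u where u: "u \<in> carrier_vec n" "u \<noteq> 0\<^sub>v n" "?A *\<^sub>v u = z \<cdot>\<^sub>v u"
    using ev cA unfolding eigenvalue_def eigenvector_def by auto
  have cu: "conjugate u \<in> carrier_vec n" using u by simp
  have conj: "conjugate (?A *\<^sub>v u) = ?A *\<^sub>v conjugate u"
  proof (rule eq_vecI)
    fix i assume "i < dim_vec (?A *\<^sub>v conjugate u)"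
    then have i: "i < n" using cA by simp
    have "conjugate (row ?A i) = row ?A i"
      by (rule eq_vecI) (use cA i in auto)
    then have "conjugate (row ?A i \<bullet> u) = row ?A i \<bullet>c u"
      using conjugate_sprod_vec[of "row ?A i" n u] row_carrier[of ?A i] cA u(1) by simp
    then show "conjugate (?A *\<^sub>v u) $ i = (?A *\<^sub>v conjugate u) $ i"
      using cA i by simp
  qed simp
  have "z * (u \<bullet>c u) = (?A *\<^sub>v u) \<bullet>c u" using u by simp
  also have "\<dots> = u \<bullet> (?A *\<^sub>v conjugate u)"
    using transpose_vec_mult_scalar[OF cA cu u(1)] sA by simp
  also have "\<dots> = cnj z * (u \<bullet>c u)"
    using u by (simp add: conj[symmetric] conjugate_smult_vec)
  finally have "(z - cnj z) * (u \<bullet>c u) = 0" by (simp add: algebra_simps)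
  moreover have "u \<bullet>c u \<noteq> 0" using u by simp
  ultimately have "cnj z = z" by simp
  then show ?thesis by (simp add: Reals_cnj_iff)
qed

text \<open>The characteristic polynomial factors over the complex numbers and all its roots are
  real. Since \<open>map_poly complex_of_real\<close> is an injective homomorphism, the
  factorization descends to the reals.\<close>

lemma sym_mats_char_poly_splits:
  assumes A: "A \<in> sym_mats n"
  shows "\<exists>es. char_poly A = (\<Prod>e\<leftarrow>es. [:- e, 1:]) \<and> length es = n"
proof -
  let ?A = "map_mat complex_of_real A"
  have cA: "?A \<in> carrier_mat n n" using sym_mats_carrier[OF A] by simp
  from char_poly_factorized[OF cA] obtain as
    where as: "char_poly ?A = (\<Prod>a\<leftarrow>as. [:- a, 1:])" "length as = n" by auto
  have real: "a \<in> \<real>" if "a \<in> set as" for a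
  proof -
    have "poly (char_poly ?A) a = 0"
      unfolding as poly_prod_list using that by (auto simp: prod_list_zero_iff)
    then show ?thesis
      using sym_mats_eigenvalue_real[OF A] eigenvalue_root_char_poly[OF cA] by blast
  qed
  define es where "es = map Re as"
  have as_es: "as = map complex_of_real es"
    unfolding es_def map_map by (rule map_idI[symmetric]) (simp add: real)
  interpret hp: map_poly_inj_comm_ring_hom complex_of_real ..
  have "map_poly complex_of_real (char_poly A) = char_poly ?A"
    by (rule of_real_hom.char_poly_hom[OF sym_mats_carrier[OF A], symmetric])
  also have "\<dots> = map_poly complex_of_real (\<Prod>e\<leftarrow>es. [:- e, 1:])"
    unfolding as as_es by (simp add: hp.hom_prod_list o_def)
  finally have "char_poly A = (\<Prod>e\<leftarrow>es. [:- e, 1:])"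
    using hp.injectivity by blast
  then show ?thesis using as as_es by auto
qed

lemma proots_linear_factors:
  "proots (\<Prod>e\<leftarrow>es. [:- e, 1:] :: real poly) = mset es"
proof (induction es)
  case (Cons e es)
  have "(\<Prod>e\<leftarrow>es. [:- e, 1:] :: real poly) \<noteq> 0"
    by (auto simp: prod_list_zero_iff)
  then show ?case using Cons by (simp add: proots_mult del: mult_pCons_left)
qed simp

lemma mset_eigvals: "mset (eigvals A) = proots (char_poly A)"
  by (simp add: eigvals_def)

text \<open>\<open>eigvals\<close> collects only real roots, so its length is not fixed in advance.
  For symmetric matrices the splitting above gives exactly \<open>n\<close> entries, and the
  factorization is in the form that \<open>schur_decomposition\<close> expects.\<close>

lemma sym_mats_char_poly_eigvals:
  assumes A: "A \<in> sym_mats n"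
  shows "char_poly A = (\<Prod>e\<leftarrow>eigvals A. [:- e, 1:])" and "length (eigvals A) = n"
proof -
  obtain es where es: "char_poly A = (\<Prod>e\<leftarrow>es. [:- e, 1:])" "length es = n"
    using sym_mats_char_poly_splits[OF A] by auto
  have m: "mset (eigvals A) = mset es"
    by (simp add: mset_eigvals es proots_linear_factors)
  then show "length (eigvals A) = n" using es mset_eq_length by metis
  from m have "mset (map (\<lambda>e. [:- e, 1:]) (eigvals A)) = mset (map (\<lambda>e. [:- e, 1:]) es)"
    by (simp only: mset_map)
  then show "char_poly A = (\<Prod>e\<leftarrow>eigvals A. [:- e, 1:])"
    unfolding es(1) by (simp only: prod_mset_prod_list[symmetric])
qed

lemma mat_trace_mult_comm:
  assumes "A \<in> carrier_mat n n" "B \<in> carrier_mat n n"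
  shows "mat_trace (A * B) = mat_trace (B * A)"
proof -
  have "mat_trace (A * B) = (\<Sum>i<n. \<Sum>k<n. A $$ (i, k) * B $$ (k, i))"
    using assms by (auto simp: mat_trace_def scalar_prod_def atLeast0LessThan)
  also have "\<dots> = (\<Sum>k<n. \<Sum>i<n. B $$ (k, i) * A $$ (i, k))"
    by (subst sum.swap) (simp add: mult.commute)
  also have "\<dots> = mat_trace (B * A)"
    using assms by (auto simp: mat_trace_def scalar_prod_def atLeast0LessThan)
  finally show ?thesis .
qed

text \<open>A Schur decomposition gives a similar matrix with \<open>eigvals A\<close> on its
  diagonal, and the trace is invariant under similarity.\<close>

lemma sym_mats_trace_eigvals:
  assumes A: "A \<in> sym_mats n"
  shows "mat_trace A = sum_list (eigvals A)"
proof -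
  note cA = sym_mats_carrier[OF A]
  obtain B P Q where "schur_decomposition A (eigvals A) = (B, P, Q)"
    by (cases "schur_decomposition A (eigvals A)")
  from schur_decomposition[OF cA sym_mats_char_poly_eigvals(1)[OF A] this]
  have wit: "similar_mat_wit A B P Q" and diag: "diag_mat B = eigvals A" by auto
  note w = similar_mat_witD2[OF cA wit]
  have "mat_trace A = mat_trace (P * (B * Q))" using w by simp
  also have "\<dots> = mat_trace (B * Q * P)" using w by (intro mat_trace_mult_comm) auto
  also have "B * Q * P = B" using w by (simp add: assoc_mult_mat[of _ n n _ n _ n])
  also have "mat_trace B = sum_list (diag_mat B)"
    by (simp add: mat_trace_def diag_mat_def sum_list_distinct_conv_sum_set
        atLeast0LessThan)
  finally show ?thesis by (simp add: diag)
qed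

lemma eigval_antimono:
  assumes A: "A \<in> sym_mats n" and "1 \<le> i" "i \<le> j" "j \<le> n"
  shows "eigval A j \<le> eigval A i"
proof -
  have "sorted (rev (eigvals A))" by (simp add: eigvals_def)
  then show ?thesis
    using assms sym_mats_char_poly_eigvals(2)[OF A]
    unfolding eigval_def by (intro sorted_rev_nth_mono) auto
qed

lemma sum_eigval:
  assumes A: "A \<in> sym_mats n"
  shows "(\<Sum>k<n. eigval A (Suc k)) = mat_trace A"
  using sym_mats_trace_eigvals[OF A] sym_mats_char_poly_eigvals(2)[OF A]
  by (simp add: sum_list_sum_nth atLeast0LessThan eigval_def)

text \<open>The quadratic form at an eigenvector is the eigenvalue times a positive squared
  norm.\<close>

lemma psd_eigval_nonneg:
  assumes A: "psd n A" and "k < n"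
  shows "0 \<le> eigval A (Suc k)"
proof -
  have sym: "A \<in> sym_mats n" using A by (simp add: psd_def)
  note cA = sym_mats_carrier[OF sym] and len = sym_mats_char_poly_eigvals(2)[OF sym]
  let ?e = "eigval A (Suc k)"
  have "?e \<in> set (eigvals A)" using assms(2) len by (simp add: eigval_def)
  then have "poly (char_poly A) ?e = 0"
    unfolding sym_mats_char_poly_eigvals(1)[OF sym] poly_prod_list
    by (auto simp: prod_list_zero_iff)
  then have "eigenvalue A ?e" using eigenvalue_root_char_poly[OF cA] by blast
  then obtain u where u: "u \<in> carrier_vec n" "u \<noteq> 0\<^sub>v n" "A *\<^sub>v u = ?e \<cdot>\<^sub>v u"
    using cA unfolding eigenvalue_def eigenvector_def by auto
  have "u \<bullet> (A *\<^sub>v u) = ?e * (u \<bullet> u)" unfolding u(3) using u(1) by simp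
  moreover have "0 \<le> u \<bullet> (A *\<^sub>v u)" using A u(1) by (simp add: psd_def)
  ultimately have "0 \<le> ?e * (u \<bullet> u)" by simp
  moreover have "0 < u \<bullet> u"
    using u conjugate_square_greater_0_vec[of u n] by (simp add: vec_conjugate_real)
  ultimately show ?thesis by (simp add: zero_le_mult_iff)
qed

section \<open>Rearrangement inequality for doubly stochastic weights\<close>

text \<open>The potential \<open>w\<close> is a dual solution of the assignment problem with cost
  \<open>m i * g j\<close>, certifying that the identity assignment is optimal.\<close>

lemma doubly_stochastic_rearrangement:
  fixes D :: "nat \<Rightarrow> nat \<Rightarrow> real" and l m g :: "nat \<Rightarrow> real"
  assumes nonneg: "\<And>i j. i < n \<Longrightarrow> j < n \<Longrightarrow> 0 \<le> D i j"
    and rows: "\<And>i. i < n \<Longrightarrow> (\<Sum>j<n. D i j) = 1"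
    and cols: "\<And>j. j < n \<Longrightarrow> (\<Sum>i<n. D i j) = 1"
    and m: "\<And>i j. i \<le> j \<Longrightarrow> j < n \<Longrightarrow> m j \<le> m i"
    and g: "\<And>i j. i \<le> j \<Longrightarrow> j < n \<Longrightarrow> g i \<le> g j"
    and ml: "\<And>i. i < n \<Longrightarrow> m i \<le> l i"
  shows "(\<Sum>i<n. m i * g i) + (\<Sum>i<n. l i - m i) * g 0
    \<le> (\<Sum>i<n. \<Sum>j<n. l i * g j * D i j)"
proof -
  define w where "w j = (\<Sum>s<j. m s * (g (Suc s) - g s))" for j
  \<comment> \<open>The left side sums \<open>m s * (g (Suc s) - g s)\<close> over \<open>s\<close>
    from \<open>i\<close> to \<open>j - 1\<close>, where \<open>m s \<le> m i\<close>. In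
    \<open>down\<close> the summation runs below \<open>i\<close>, where
    \<open>m s \<ge> m i\<close>.\<close>
  have up: "w j - w i \<le> m i * (g j - g i)" if "i \<le> j" "j < n" for i j
    using that
  proof (induction j rule: dec_induct)
    case (step j)
    have "m j * (g (Suc j) - g j) \<le> m i * (g (Suc j) - g j)"
      using step g[of j "Suc j"] m[of i j] by (intro mult_right_mono) auto
    then show ?case using step by (simp add: w_def algebra_simps)
  qed simp
  have down: "m i * (g i - g j) \<le> w i - w j" if "j \<le> i" "i < n" for i j
    using that
  proof (induction j rule: inc_induct)
    case (step j)
    have "m i * (g (Suc j) - g j) \<le> m j * (g (Suc j) - g j)"
      using step g[of j "Suc j"] m[of j i] by (intro mult_right_mono) auto
    then show ?case using step by (simp add: w_def algebra_simps)
  qed simp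
  \<comment> \<open>\<open>c\<close> is the row potential matching the column potential
    \<open>w\<close>, and \<open>cell\<close> is dual feasibility. The cost of \<open>l i\<close> is
    split into the part \<open>m i\<close>, bounded through \<open>w\<close>, and the excess, priced
    at the cheapest rate \<open>g 0\<close>.\<close>
  define c where "c i = m i * g i - w i + (l i - m i) * g 0" for i
  have cell: "c i + w j \<le> l i * g j" if "i < n" "j < n" for i j
  proof -
    have "(l i - m i) * g 0 \<le> (l i - m i) * g j"
      using that ml g[of 0 j] by (intro mult_left_mono) auto
    moreover have "w j - w i \<le> m i * (g j - g i)"
      using up[of i j] down[of j i] that by (cases "i \<le> j") (auto simp: algebra_simps)
    ultimately show ?thesis by (simp add: c_def algebra_simps)
  qed
  \<comment> \<open>The potentials \<open>w\<close> cancel in the sum; unit row and column sums then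
    spread \<open>c\<close> and \<open>w\<close> over the cells of \<open>D\<close>.\<close>
  have "(\<Sum>i<n. m i * g i) + (\<Sum>i<n. l i - m i) * g 0 = (\<Sum>i<n. c i) + (\<Sum>j<n. w j)"
    by (simp add: c_def sum.distrib sum_subtractf flip: sum_distrib_right)
  also have "(\<Sum>i<n. c i) = (\<Sum>i<n. \<Sum>j<n. c i * D i j)"
    by (simp add: rows flip: sum_distrib_left)
  also have "(\<Sum>j<n. w j) = (\<Sum>i<n. \<Sum>j<n. w j * D i j)"
    by (subst sum.swap) (simp add: cols flip: sum_distrib_left)
  also have "(\<Sum>i<n. \<Sum>j<n. c i * D i j) + (\<Sum>i<n. \<Sum>j<n. w j * D i j)
      = (\<Sum>i<n. \<Sum>j<n. (c i + w j) * D i j)"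
    by (simp add: sum.distrib algebra_simps)
  also have "\<dots> \<le> (\<Sum>i<n. \<Sum>j<n. l i * g j * D i j)"
    by (intro sum_mono mult_right_mono cell nonneg) auto
  finally show ?thesis .
qed

section \<open>Orthogonal conjugates of diagonal matrices\<close>

lemma index_conj_mat_diag:
  fixes Q :: "real mat"
  assumes "Q \<in> carrier_mat n r" "a < n" "b < n"
  shows "(Q * mat_diag r l * Q\<^sup>T) $$ (a, b) = (\<Sum>k<r. l k * Q $$ (a, k) * Q $$ (b, k))"
proof -
  have "(Q * mat_diag r l * Q\<^sup>T) $$ (a, b) = (\<Sum>k<r. Q $$ (a, k) * l k * Q $$ (b, k))"
    using assms by (simp add: mat_diag_mult_right[OF assms(1)] scalar_prod_def atLeast0LessThan)
  then show ?thesis by (simp add: mult_ac)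
qed

lemma sum_mult_delta:
  fixes f :: "nat \<Rightarrow> real"
  assumes "i < n"
  shows "(\<Sum>k<n. f k * (if k = i then 1 else 0)) = f i"
    and "(\<Sum>k<n. f k * (if i = k then 1 else 0)) = f i"
  using assms by (simp_all add: if_distrib cong: if_cong)

lemma orth_group_cols:
  assumes "Q \<in> orth_group n" "i < n" "j < n"
  shows "(\<Sum>a<n. Q $$ (a, i) * Q $$ (a, j)) = (if i = j then 1 else 0)"
proof -
  have c: "Q \<in> carrier_mat n n" and o: "Q * Q\<^sup>T = 1\<^sub>m n" using assms by (auto simp: orth_group_def)
  have "Q\<^sup>T * Q = 1\<^sub>m n" using mat_mult_left_right_inverse[OF c _ o] c by simp
  then have "(Q\<^sup>T * Q) $$ (i, j) = (if i = j then 1 else 0)" using assms by simp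
  then show ?thesis using assms c by (simp add: scalar_prod_def atLeast0LessThan)
qed

lemma orth_group_rows:
  assumes "Q \<in> orth_group n" "i < n" "j < n"
  shows "(\<Sum>a<n. Q $$ (i, a) * Q $$ (j, a)) = (if i = j then 1 else 0)"
proof -
  have c: "Q \<in> carrier_mat n n" and o: "Q * Q\<^sup>T = 1\<^sub>m n" using assms by (auto simp: orth_group_def)
  have "(Q * Q\<^sup>T) $$ (i, j) = (if i = j then 1 else 0)" using assms o by simp
  then show ?thesis using assms c by (simp add: scalar_prod_def atLeast0LessThan)
qed

text \<open>Row \<open>i\<close> of the orthogonal matrix \<open>Q\<^sup>T * U\<close> has norm one.
  Exchanging \<open>Q\<close> and \<open>U\<close> yields the same for columns, so the squared
  entries are doubly stochastic.\<close>

lemma orth_group_sum_squares: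
  assumes Q: "Q \<in> orth_group n" and U: "U \<in> orth_group n" and "i < n"
  shows "(\<Sum>j<n. (\<Sum>a<n. Q $$ (a, i) * U $$ (a, j))\<^sup>2) = 1"
proof -
  have "(\<Sum>j<n. (\<Sum>a<n. Q $$ (a, i) * U $$ (a, j))\<^sup>2)
    = (\<Sum>j<n. \<Sum>a<n. \<Sum>b<n. Q $$ (a, i) * Q $$ (b, i) * (U $$ (a, j) * U $$ (b, j)))"
    by (simp add: power2_eq_square sum_product mult_ac)
  also have "\<dots> = (\<Sum>a<n. \<Sum>b<n. \<Sum>j<n. Q $$ (a, i) * Q $$ (b, i) * (U $$ (a, j) * U $$ (b, j)))"
    by (subst sum.swap, rule sum.cong[OF refl], rule sum.swap)
  \<comment> \<open>With \<open>j\<close> summed innermost, orthonormality of the rows of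
    \<open>U\<close> leaves only the terms \<open>a = b\<close>.\<close>
  also have "\<dots> = (\<Sum>a<n. Q $$ (a, i) * Q $$ (a, i))"
    by (simp add: orth_group_rows[OF U] sum_mult_delta flip: sum_distrib_left)
  also have "\<dots> = 1" using orth_group_cols[OF Q \<open>i < n\<close> \<open>i < n\<close>] by simp
  finally show ?thesis .
qed

lemma conj_mat_diag_sym:
  assumes "Q \<in> carrier_mat n n"
  shows "Q * mat_diag n l * Q\<^sup>T \<in> sym_mats n"
  unfolding sym_mats_def
proof (intro CollectI conjI eq_matI)
  fix i j assume "i < dim_row (Q * mat_diag n l * Q\<^sup>T)" "j < dim_col (Q * mat_diag n l * Q\<^sup>T)"
  then have "i < n" "j < n" using assms by auto
  then show "(Q * mat_diag n l * Q\<^sup>T)\<^sup>T $$ (i, j) = (Q * mat_diag n l * Q\<^sup>T) $$ (i, j)"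
    using assms by (simp add: index_conj_mat_diag mult_ac del: index_mult_mat(1))
qed (use assms in \<open>auto simp: mult_carrier_mat[of _ n n]\<close>)

lemma trace_conj_mat_diag:
  assumes Q: "Q \<in> orth_group n"
  shows "mat_trace (Q * mat_diag n l * Q\<^sup>T) = (\<Sum>k<n. l k)"
proof -
  have c: "Q \<in> carrier_mat n n" using Q by (simp add: orth_group_def)
  have "mat_trace (Q * mat_diag n l * Q\<^sup>T) = (\<Sum>a<n. \<Sum>k<n. l k * (Q $$ (a, k) * Q $$ (a, k)))"
    using c by (simp add: mat_trace_def index_conj_mat_diag mult.assoc del: index_mult_mat(1))
  also have "\<dots> = (\<Sum>k<n. \<Sum>a<n. l k * (Q $$ (a, k) * Q $$ (a, k)))" by (rule sum.swap)
  also have "\<dots> = (\<Sum>k<n. l k)" by (simp add: orth_group_cols[OF Q] flip: sum_distrib_left)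
  finally show ?thesis .
qed

lemma quadratic_form_conj_mat_diag:
  fixes Q :: "real mat"
  assumes c: "Q \<in> carrier_mat n n" and x: "x \<in> carrier_vec n"
  shows "x \<bullet> ((Q * mat_diag n l * Q\<^sup>T) *\<^sub>v x) = (\<Sum>k<n. l k * (\<Sum>a<n. Q $$ (a, k) * x $ a)\<^sup>2)"
proof -
  let ?Y = "Q * mat_diag n l * Q\<^sup>T"
  have Y: "?Y \<in> carrier_mat n n" using c by (simp add: mult_carrier_mat[of _ n n])
  have "x \<bullet> (?Y *\<^sub>v x) = (\<Sum>a<n. \<Sum>b<n. x $ a * (?Y $$ (a, b) * x $ b))"
    using Y x by (auto simp: scalar_prod_def atLeast0LessThan sum_distrib_left simp del: index_mult_mat(1))
  also have "\<dots> = (\<Sum>a<n. \<Sum>b<n. \<Sum>k<n. l k * (Q $$ (a, k) * x $ a * (Q $$ (b, k) * x $ b)))"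
    using c by (simp add: index_conj_mat_diag sum_distrib_left sum_distrib_right del: index_mult_mat(1))
      (simp add: mult_ac)
  also have "\<dots> = (\<Sum>a<n. \<Sum>k<n. \<Sum>b<n. l k * (Q $$ (a, k) * x $ a * (Q $$ (b, k) * x $ b)))"
    by (rule sum.cong[OF refl], rule sum.swap)
  also have "\<dots> = (\<Sum>k<n. \<Sum>a<n. \<Sum>b<n. l k * (Q $$ (a, k) * x $ a * (Q $$ (b, k) * x $ b)))"
    by (rule sum.swap)
  also have "\<dots> = (\<Sum>k<n. l k * (\<Sum>a<n. Q $$ (a, k) * x $ a)\<^sup>2)"
    by (simp add: power2_eq_square sum_product flip: sum_distrib_left)
  finally show ?thesis .
qed

text \<open>The quadratic form is a sum of squares weighted by \<open>l\<close>; evaluating it at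
  column \<open>i\<close> of \<open>Q\<close> isolates \<open>l i\<close>.\<close>

lemma psd_conj_mat_diag_iff:
  assumes Q: "Q \<in> orth_group n"
  shows "psd n (Q * mat_diag n l * Q\<^sup>T) \<longleftrightarrow> (\<forall>k<n. 0 \<le> l k)"
proof
  have c: "Q \<in> carrier_mat n n" using Q by (simp add: orth_group_def)
  show "psd n (Q * mat_diag n l * Q\<^sup>T)" if "\<forall>k<n. 0 \<le> l k"
    using that conj_mat_diag_sym[OF c]
    by (auto simp: psd_def quadratic_form_conj_mat_diag[OF c] intro!: sum_nonneg)
  assume psd: "psd n (Q * mat_diag n l * Q\<^sup>T)"
  show "\<forall>k<n. 0 \<le> l k"
  proof (intro allI impI)
    fix i assume i: "i < n"
    have x: "col Q i \<in> carrier_vec n" using c by auto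
    have "0 \<le> (\<Sum>k<n. l k * (\<Sum>a<n. Q $$ (a, k) * col Q i $ a)\<^sup>2)"
      using psd x by (simp add: psd_def flip: quadratic_form_conj_mat_diag[OF c x])
    also have "\<dots> = (\<Sum>k<n. l k * (if k = i then 1 else 0))"
      using c i orth_group_cols[OF Q _ i] by (intro sum.cong) auto
    also have "\<dots> = l i" using i by (rule sum_mult_delta)
    finally show "0 \<le> l i" .
  qed
qed

text \<open>Expanding both matrices entrywise gives a fourfold sum. Once the row indices
  \<open>a\<close> and \<open>b\<close> are innermost, their double sum factors into the square of
  one entry of \<open>Q\<^sup>T * U\<close>.\<close>

lemma trace_inner_conj_mat_diag:
  assumes Q: "Q \<in> carrier_mat n n" and U: "U \<in> carrier_mat n n"
  shows "trace_inner (Q * mat_diag n l * Q\<^sup>T) (U * mat_diag n g * U\<^sup>T)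
    = (\<Sum>i<n. \<Sum>j<n. l i * g j * (\<Sum>a<n. Q $$ (a, i) * U $$ (a, j))\<^sup>2)"
proof -
  let ?Y = "Q * mat_diag n l * Q\<^sup>T" and ?G = "U * mat_diag n g * U\<^sup>T"
  have Y: "?Y \<in> carrier_mat n n" using Q by (simp add: mult_carrier_mat[of _ n n])
  have G: "?G \<in> carrier_mat n n" using U by (simp add: mult_carrier_mat[of _ n n])
  let ?t = "\<lambda>b a i j. l i * g j * ((Q $$ (a, i) * U $$ (a, j)) * (Q $$ (b, i) * U $$ (b, j)))"
  have "trace_inner A B = (\<Sum>b<n. \<Sum>a<n. A $$ (a, b) * B $$ (a, b))"
    if "A \<in> carrier_mat n n" "B \<in> carrier_mat n n" for A B
    using that by (auto simp: trace_inner_def mat_trace_def scalar_prod_def atLeast0LessThan)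
  then have "trace_inner ?Y ?G = (\<Sum>b<n. \<Sum>a<n. ?Y $$ (a, b) * ?G $$ (a, b))"
    using Y G by blast
  also have "\<dots> = (\<Sum>b<n. \<Sum>a<n. \<Sum>i<n. \<Sum>j<n. ?t b a i j)"
    using Q U by (simp add: index_conj_mat_diag sum_product del: index_mult_mat(1))
      (simp add: mult_ac)
  also have "\<dots> = (\<Sum>b<n. \<Sum>i<n. \<Sum>a<n. \<Sum>j<n. ?t b a i j)"
    by (rule sum.cong[OF refl], rule sum.swap)
  also have "\<dots> = (\<Sum>b<n. \<Sum>i<n. \<Sum>j<n. \<Sum>a<n. ?t b a i j)"
    by (rule sum.cong[OF refl], rule sum.cong[OF refl], rule sum.swap)
  also have "\<dots> = (\<Sum>i<n. \<Sum>b<n. \<Sum>j<n. \<Sum>a<n. ?t b a i j)"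
    by (rule sum.swap)
  also have "\<dots> = (\<Sum>i<n. \<Sum>j<n. \<Sum>b<n. \<Sum>a<n. ?t b a i j)"
    by (rule sum.cong[OF refl], rule sum.swap)
  also have "\<dots> = (\<Sum>i<n. \<Sum>j<n. \<Sum>a<n. \<Sum>b<n. ?t b a i j)"
    by (rule sum.cong[OF refl], rule sum.cong[OF refl], rule sum.swap)
  also have "\<dots> = (\<Sum>i<n. \<Sum>j<n. l i * g j * (\<Sum>a<n. Q $$ (a, i) * U $$ (a, j))\<^sup>2)"
    by (simp add: power2_eq_square sum_product flip: sum_distrib_left)
  finally show ?thesis .
qed

section \<open>Diagonalization of \<open>G\<close> and of the thresholding mapping in one
  basis\<close>

text \<open>The basis is reversed, so that the column index \<open>k < n\<close> belongs to the \<open>k\<close>-th smallest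
  eigenvalue \<open>eigval G (n - k)\<close>, counting from 0.\<close>

definition eigenbasis_mat :: "nat \<Rightarrow> (nat \<Rightarrow> real vec) \<Rightarrow> real mat" where
  "eigenbasis_mat n v = mat_of_cols n (map (\<lambda>k. v (n - k)) [0..<n])"

lemma eigenbasis_mat_carrier [simp]: "eigenbasis_mat n v \<in> carrier_mat n n"
  by (auto simp: eigenbasis_mat_def)

lemma index_eigenbasis_mat:
  "a < n \<Longrightarrow> k < n \<Longrightarrow> eigenbasis_mat n v $$ (a, k) = v (n - k) $ a"
  by (simp add: eigenbasis_mat_def mat_of_cols_index)

lemma col_eigenbasis_mat:
  assumes "ordered_eigenbasis n G v" "k < n"
  shows "col (eigenbasis_mat n v) k = v (n - k)"
  using assms by (auto simp: ordered_eigenbasis_def eigenbasis_mat_def)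

text \<open>Orthonormality of the columns makes the transpose a left inverse, and for square
  matrices this is also a right inverse.\<close>

lemma eigenbasis_mat_orth:
  assumes v: "ordered_eigenbasis n G v"
  shows "eigenbasis_mat n v \<in> orth_group n"
proof -
  let ?U = "eigenbasis_mat n v"
  have "?U\<^sup>T * ?U = 1\<^sub>m n"
  proof (rule eq_matI)
    fix i j assume "i < dim_row (1\<^sub>m n)" "j < dim_col (1\<^sub>m n)"
    then have ij: "i < n" "j < n" by auto
    then have "(?U\<^sup>T * ?U) $$ (i, j) = v (n - i) \<bullet> v (n - j)"
      by (simp add: col_eigenbasis_mat[OF v] carrier_matD[OF eigenbasis_mat_carrier])
    also have "\<dots> = (if n - i = n - j then 1 else 0)"
      using v ij by (simp add: ordered_eigenbasis_def)
    finally show "(?U\<^sup>T * ?U) $$ (i, j) = 1\<^sub>m n $$ (i, j)" using ij by auto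
  qed (auto simp: carrier_matD[OF eigenbasis_mat_carrier])
  then show ?thesis
    using mat_mult_left_right_inverse[of "?U\<^sup>T" n ?U] by (simp add: orth_group_def)
qed

lemma ordered_eigenbasis_decomp:
  assumes cG: "G \<in> carrier_mat n n" and v: "ordered_eigenbasis n G v"
  shows "G = eigenbasis_mat n v * mat_diag n (\<lambda>k. eigval G (n - k)) * (eigenbasis_mat n v)\<^sup>T"
proof -
  let ?U = "eigenbasis_mat n v" and ?g = "\<lambda>k. eigval G (n - k)"
  note cU = eigenbasis_mat_carrier[of n v]
  have "G * ?U = ?U * mat_diag n ?g"
  proof (rule eq_matI)
    fix a k assume "a < dim_row (?U * mat_diag n ?g)" "k < dim_col (?U * mat_diag n ?g)"
    then have ak: "a < n" "k < n" using cU by (auto simp: mat_diag_def)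
    then have vk: "v (n - k) \<in> carrier_vec n" "G *\<^sub>v v (n - k) = ?g k \<cdot>\<^sub>v v (n - k)"
      using v by (auto simp: ordered_eigenbasis_def)
    have "(G * ?U) $$ (a, k) = (G *\<^sub>v v (n - k)) $ a"
      using ak cG carrier_matD[OF cU] by (simp add: col_eigenbasis_mat[OF v])
    also have "\<dots> = ?g k * v (n - k) $ a" using ak vk by simp
    also have "\<dots> = (?U * mat_diag n ?g) $$ (a, k)"
      using ak by (simp add: mat_diag_mult_right[OF cU] index_eigenbasis_mat)
    finally show "(G * ?U) $$ (a, k) = (?U * mat_diag n ?g) $$ (a, k)" .
  qed (use cG carrier_matD[OF cU] in \<open>simp_all add: mat_diag_def\<close>)
  then have "?U * mat_diag n ?g * ?U\<^sup>T = G * (?U * ?U\<^sup>T)"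
    using assoc_mult_mat[OF cG cU, of "?U\<^sup>T" n] by simp
  also have "\<dots> = G" using eigenbasis_mat_orth[OF v] cG by (simp add: orth_group_def)
  finally show ?thesis by simp
qed

text \<open>These are the weights of the thresholding mapping on the columns of
  \<open>eigenbasis_mat n v\<close>. Column 0 is \<open>v n\<close>, so the rank-one term adds to
  the weight at \<open>k = 0\<close>.\<close>

definition thresh_weight :: "nat \<Rightarrow> real mat \<Rightarrow> real \<Rightarrow> nat \<Rightarrow> nat \<Rightarrow> real" where
  "thresh_weight n X d r k =
     (if k < r then eigval X (Suc k) - d else 0) + (if k = 0 then real n * thresh_shift n X d r else 0)"

text \<open>\<open>V\<close> consists of the first \<open>r\<close> columns of
  \<open>eigenbasis_mat n v\<close>, and \<open>v n\<close> is its column 0. Padding with zero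
  weights therefore merges both terms into one conjugated diagonal matrix, also for
  \<open>r = 0\<close>.\<close>

lemma thresh_map_eq:
  assumes n: "0 < n" and r: "r \<le> n"
  shows "thresh_map n X v d r
    = eigenbasis_mat n v * mat_diag n (thresh_weight n X d r) * (eigenbasis_mat n v)\<^sup>T"
proof -
  let ?U = "eigenbasis_mat n v" and ?y = "thresh_weight n X d r"
  let ?m = "\<lambda>k. eigval X (Suc k) - d" and ?c = "real n * thresh_shift n X d r"
  define V where "V = mat_of_cols n (map (\<lambda>k. v (n - k)) [0..<r])"
  define w where "w = mat_of_cols n [v n]"
  have cV: "V \<in> carrier_mat n r" by (auto simp: V_def)
  have cw: "w \<in> carrier_mat n 1" by (auto simp: w_def)
  have "mat_diag r (\<lambda>k. eigval X (k + 1)) - d \<cdot>\<^sub>m 1\<^sub>m r = mat_diag r ?m"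
    by (rule eq_matI) (auto simp: mat_diag_def)
  then have map: "thresh_map n X v d r = V * mat_diag r ?m * V\<^sup>T + ?c \<cdot>\<^sub>m (w * w\<^sup>T)"
    by (simp add: thresh_map_def V_def w_def Let_def)
  have cVm: "V * mat_diag r ?m * V\<^sup>T \<in> carrier_mat n n"
    using cV by (simp add: mult_carrier_mat[of _ n r])
  have cww: "w * w\<^sup>T \<in> carrier_mat n n" using cw by (simp add: mult_carrier_mat[of _ n 1])
  show ?thesis
  proof (rule eq_matI)
    fix a b assume "a < dim_row (?U * mat_diag n ?y * ?U\<^sup>T)" "b < dim_col (?U * mat_diag n ?y * ?U\<^sup>T)"
    then have ab: "a < n" "b < n" by (auto simp: carrier_matD[OF eigenbasis_mat_carrier])
    let ?p = "\<lambda>k. v (n - k) $ a * v (n - k) $ b"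
    have "(w * w\<^sup>T) $$ (a, b) = ?p 0"
      using ab cw by (simp add: scalar_prod_def w_def mat_of_cols_index)
    \<comment> \<open>\<open>index_conj_mat_diag\<close> covers rectangular matrices, here with
      \<open>r\<close> columns.\<close>
    moreover have "(V * mat_diag r ?m * V\<^sup>T) $$ (a, b) = (\<Sum>k<r. ?m k * ?p k)"
      using ab unfolding index_conj_mat_diag[OF cV ab]
      by (simp add: V_def mat_of_cols_index mult.assoc)
    ultimately have "thresh_map n X v d r $$ (a, b) = (\<Sum>k<r. ?m k * ?p k) + ?c * ?p 0"
      unfolding map using ab carrier_matD[OF cVm] carrier_matD[OF cww]
      by (simp del: index_mult_mat)
    also have "(\<Sum>k<r. ?m k * ?p k) = (\<Sum>k<n. (if k < r then ?m k else 0) * ?p k)"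
      using r by (intro sum.mono_neutral_cong_left) auto
    also have "?c * ?p 0 = (\<Sum>k<n. (if k = 0 then ?c else 0) * ?p k)"
      using sum_mult_delta(1)[OF n, of "\<lambda>k. ?c * ?p k", symmetric]
      by (simp only:) (intro sum.cong refl, simp)
    also have "(\<Sum>k<n. (if k < r then ?m k else 0) * ?p k) + (\<Sum>k<n. (if k = 0 then ?c else 0) * ?p k)
        = (\<Sum>k<n. ?y k * ?p k)"
      unfolding thresh_weight_def distrib_right sum.distrib ..
    also have "\<dots> = (?U * mat_diag n ?y * ?U\<^sup>T) $$ (a, b)"
      using ab by (simp add: index_conj_mat_diag[OF eigenbasis_mat_carrier] index_eigenbasis_mat mult.assoc del: index_mult_mat(1))
    finally show "thresh_map n X v d r $$ (a, b) = (?U * mat_diag n ?y * ?U\<^sup>T) $$ (a, b)" .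
  qed (use cVm cww in \<open>auto simp: map carrier_matD[OF eigenbasis_mat_carrier]\<close>)
qed

section \<open>The thresholding rank\<close>

lemma thresh_rank_le: "thresh_rank n X d \<le> n"
proof -
  have "Max I \<le> n" if "I \<subseteq> {1..n}" "I \<noteq> {}" for I :: "nat set"
    using that Max_in[of I] finite_subset[of I "{1..n}"] by auto
  then show ?thesis by (simp add: thresh_rank_def Let_def Collect_restrict)
qed

text \<open>Since the eigenvalues decrease, the indices with eigenvalue above \<open>d\<close> form
  an initial segment of \<open>{1..n}\<close>, whose maximum is its length. \<open>Suc k\<close>
  passes from counting from 0 to counting from 1.\<close>

lemma thresh_rank_less_iff:
  assumes X: "X \<in> sym_mats n" and k: "k < n"
  shows "k < thresh_rank n X d \<longleftrightarrow> d < eigval X (Suc k)"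
proof -
  define I where "I = {i \<in> {1..n}. d < eigval X i}"
  have fin: "finite I" by (simp add: I_def)
  have r: "thresh_rank n X d = (if I = {} then 0 else Max I)"
    unfolding thresh_rank_def I_def Let_def ..
  show ?thesis
  proof
    assume "k < thresh_rank n X d"
    then have "k < Max I" "I \<noteq> {}" by (auto simp: r split: if_splits)
    moreover have "Max I \<in> I" using calculation fin by simp
    ultimately show "d < eigval X (Suc k)"
      using eigval_antimono[OF X, of "Suc k" "Max I"] by (auto simp: I_def)
  next
    assume "d < eigval X (Suc k)"
    then have "Suc k \<in> I" using k by (simp add: I_def)
    then show "k < thresh_rank n X d" using Max_ge[OF fin] by (force simp: r)
  qed
qed

section \<open>Feasibility and optimality of the thresholding mapping\<close>

theorem lemma3p7:
  fixes n :: nat and X G :: "real mat" and d :: real and v :: "nat \<Rightarrow> real vec"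
  assumes "X \<in> spectraplex n"
    and "G \<in> sym_mats n"
    and "d > 0"
    and "ordered_eigenbasis n G v"
  shows "is_arg_min (\<lambda>Y. trace_inner Y G) (\<lambda>Y. Y \<in> spectraplex n \<inter> spectral_ball n X d)
           (thresh_map n X v d (thresh_rank n X d))"
proof -
  have X: "X \<in> sym_mats n" "mat_trace X = 1" "psd n X"
    using assms(1) by (auto simp: spectraplex_def)
  \<comment> \<open>A matrix of size 0 has trace 0, not 1.\<close>
  have n: "0 < n"
    using X sym_mats_carrier[OF X(1)] by (cases n) (auto simp: mat_trace_def)
  note v = assms(4) and d = assms(3)
  define r where "r = thresh_rank n X d"
  define x where "x k = eigval X (Suc k)" for k
  define m where "m k = (if k < r then x k - d else 0)" for k
  define c where "c = 1 - (\<Sum>k<n. m k)"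
  define y where "y = thresh_weight n X d r"
  define U where "U = eigenbasis_mat n v"
  define g where "g k = eigval G (n - k)" for k
  have r: "r \<le> n" by (simp add: r_def thresh_rank_le)
  have r_iff: "k < r \<longleftrightarrow> d < x k" if "k < n" for k
    using thresh_rank_less_iff[OF X(1) that] by (simp add: r_def x_def)
  have x_nonneg: "0 \<le> x k" if "k < n" for k
    using psd_eigval_nonneg[OF X(3) that] by (simp add: x_def)
  have x_sum: "(\<Sum>k<n. x k) = 1" using sum_eigval[OF X(1)] X(2) by (simp add: x_def)
  have x_anti: "x j \<le> x i" if "i \<le> j" "j < n" for i j
    using eigval_antimono[OF X(1), of "Suc i" "Suc j"] that by (simp add: x_def)
  have m_max: "m k = max (x k - d) 0" if "k < n" for k
    using r_iff[OF that] by (simp add: m_def)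
  \<comment> \<open>As \<open>d > 0\<close> and \<open>x k \<ge> 0\<close>, each \<open>m k\<close>
    is at most \<open>x k\<close>, and the \<open>x k\<close> sum to 1.\<close>
  have c_nonneg: "0 \<le> c"
  proof -
    have "(\<Sum>k<n. m k) \<le> (\<Sum>k<n. x k)"
      using x_nonneg d by (intro sum_mono) (auto simp: m_max)
    then show ?thesis by (simp add: c_def x_sum)
  qed
  have "(\<Sum>k<n. m k) = (\<Sum>k<r. x k - d)"
    using r by (intro sum.mono_neutral_cong_right) (auto simp: m_def)
  also have "\<dots> = (\<Sum>i=1..r. eigval X i) - real r * d"
    by (simp add: sum_subtractf x_def sum.atLeast1_atMost_eq)
  finally have "real n * thresh_shift n X d r = c"
    using n by (simp add: thresh_shift_def c_def)
  then have y: "y k = m k + (if k = 0 then c else 0)" for k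
    by (simp add: y_def thresh_weight_def m_def x_def)
  have y_nonneg: "0 \<le> y k" if "k < n" for k
    using c_nonneg m_max[OF that] by (simp add: y)
  have y_sum: "(\<Sum>k<n. y k) = 1" using n by (simp add: y sum.distrib c_def)
  have U: "U \<in> orth_group n" by (simp add: U_def eigenbasis_mat_orth[OF v])
  have cU: "U \<in> carrier_mat n n" by (simp add: U_def)
  have G: "G = U * mat_diag n g * U\<^sup>T"
    unfolding U_def g_def by (rule ordered_eigenbasis_decomp[OF sym_mats_carrier[OF assms(2)] v])
  define Z where "Z = U * mat_diag n y * U\<^sup>T"
  have Z: "thresh_map n X v d (thresh_rank n X d) = Z"
    unfolding Z_def U_def y_def using thresh_map_eq[OF n r] by (simp add: r_def)
  have ev: "dim_vec (eigval_vec X) = n" "eigval_vec X $ k = x k" for k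
    using sym_mats_char_poly_eigvals(2)[OF X(1)]
    by (simp_all add: eigval_vec_def x_def eigval_def vec_of_list_index)
  have Z_plex: "Z \<in> spectraplex n"
    using conj_mat_diag_sym[OF cU] psd_conj_mat_diag_iff[OF U] trace_conj_mat_diag[OF U]
      y_nonneg y_sum
    by (simp add: spectraplex_def Z_def)
  have Z_ball: "Z \<in> spectral_ball n X d"
  proof -
    \<comment> \<open>Obtained by solving \<open>y k = x k - d + n * d * e k\<close> for
      \<open>e\<close>. Nonnegativity follows from \<open>y k \<ge> m k \<ge> x k - d\<close>, and
      the entries sum to 1 because \<open>x\<close> and \<open>y\<close> have equal sums.\<close>
    define e where "e = vec n (\<lambda>k. (y k - x k + d) / (real n * d))"
    have "0 \<le> y k - x k + d" if "k < n" for k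
      using max.cobounded1[of "x k - d" 0] m_max[OF that] c_nonneg unfolding y by auto
    moreover have "(\<Sum>k<n. y k - x k + d) = real n * d"
      by (simp add: sum.distrib sum_subtractf y_sum x_sum)
    ultimately have "e \<in> simplex n"
      using n d by (auto simp: simplex_def e_def simp flip: sum_divide_distrib)
    moreover have "vec n y = eigval_vec X - d \<cdot>\<^sub>v vec n (\<lambda>_. 1) + (real n * d) \<cdot>\<^sub>v e"
      using n d ev by (intro eq_vecI) (auto simp: e_def)
    ultimately have "vec n y \<in> simplex_ball n (eigval_vec X) d"
      by (auto simp: simplex_ball_def)
    \<comment> \<open>\<open>vec n y $ i\<close> is known to equal \<open>y i\<close> only for
      \<open>i < n\<close>, which suffices inside \<open>mat_diag n\<close>.\<close>
    moreover have "Z = U * mat_diag n (\<lambda>i. vec n y $ i) * U\<^sup>T"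
      unfolding Z_def by (intro arg_cong[of _ _ "\<lambda>M. U * M * U\<^sup>T"] eq_matI) (auto simp: mat_diag_def)
    ultimately show ?thesis using U unfolding spectral_ball_def by blast
  qed
  have Z_val: "trace_inner Z G = (\<Sum>k<n. m k * g k) + c * g 0"
  proof -
    \<comment> \<open>\<open>Z\<close> and \<open>G\<close> share the basis \<open>U\<close>, so the
      squared overlaps reduce to the identity matrix.\<close>
    have "trace_inner Z G = (\<Sum>i<n. \<Sum>j<n. y i * g j * (if i = j then 1 else 0))"
      unfolding Z_def G trace_inner_conj_mat_diag[OF cU cU]
      using orth_group_cols[OF U] by (intro sum.cong) auto
    also have "\<dots> = (\<Sum>k<n. y k * g k)"
      by (intro sum.cong refl sum_mult_delta) simp
    also have "\<dots> = (\<Sum>k<n. m k * g k) + c * g 0"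
      using n by (simp add: y distrib_right sum.distrib if_distrib[of "\<lambda>x. x * _"] cong: if_cong)
    finally show ?thesis .
  qed
  have bound: "trace_inner Z G \<le> trace_inner Y G"
    if Y: "Y \<in> spectraplex n" "Y \<in> spectral_ball n X d" for Y
  proof -
    obtain Q e where Q: "Q \<in> orth_group n" and e: "e \<in> simplex n"
      and Y_eq: "Y = Q * mat_diag n (\<lambda>i. (eigval_vec X - d \<cdot>\<^sub>v vec n (\<lambda>_. 1) + (real n * d) \<cdot>\<^sub>v e) $ i) * Q\<^sup>T"
      using Y(2) unfolding spectral_ball_def simplex_ball_def by auto
    define l where "l i = (eigval_vec X - d \<cdot>\<^sub>v vec n (\<lambda>_. 1) + (real n * d) \<cdot>\<^sub>v e) $ i" for i
    have Yl: "Y = Q * mat_diag n l * Q\<^sup>T" by (simp add: Y_eq l_def[abs_def])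
    have cQ: "Q \<in> carrier_mat n n" using Q by (simp add: orth_group_def)
    \<comment> \<open>Membership in the ball gives this bound, since \<open>l k\<close> exceeds
      \<open>x k - d\<close> by \<open>n * d * e k\<close>. Positive semidefiniteness of
      \<open>Y\<close> gives the bound by 0, and together they give \<open>ml\<close>.\<close>
    have "x k - d \<le> l k" if "k < n" for k
      using that ev e d by (auto simp: l_def simplex_def)
    moreover have "0 \<le> l k" if "k < n" for k
      using Y(1) that psd_conj_mat_diag_iff[OF Q] by (simp add: spectraplex_def Yl)
    ultimately have ml: "m k \<le> l k" if "k < n" for k using that by (simp add: m_max)
    have "(\<Sum>k<n. l k) = 1"
      using Y(1) trace_conj_mat_diag[OF Q] by (simp add: spectraplex_def Yl)
    \<comment> \<open>Every feasible \<open>Y\<close> has the same excess mass, so the lower bound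
      below is exactly the value attained by \<open>Z\<close>.\<close>
    then have c: "(\<Sum>k<n. l k - m k) = c" by (simp add: sum_subtractf c_def)
    define D where "D i j = (\<Sum>a<n. Q $$ (a, i) * U $$ (a, j))\<^sup>2" for i j
    have "(\<Sum>k<n. m k * g k) + (\<Sum>k<n. l k - m k) * g 0 \<le> (\<Sum>i<n. \<Sum>j<n. l i * g j * D i j)"
    proof (rule doubly_stochastic_rearrangement)
      show "(\<Sum>j<n. D i j) = 1" if "i < n" for i
        using orth_group_sum_squares[OF Q U that] by (simp add: D_def)
      show "(\<Sum>i<n. D i j) = 1" if "j < n" for j
        using orth_group_sum_squares[OF U Q that] by (simp add: D_def mult.commute)
      show "m j \<le> m i" if "i \<le> j" "j < n" for i j
        using x_anti[OF that] that by (simp add: m_max)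
      show "g i \<le> g j" if "i \<le> j" "j < n" for i j
        using eigval_antimono[OF assms(2), of "n - j" "n - i"] that by (simp add: g_def)
    qed (auto simp: D_def ml)
    also have "\<dots> = trace_inner Y G"
      unfolding Yl G D_def trace_inner_conj_mat_diag[OF cQ cU] ..
    finally show ?thesis by (simp add: Z_val c)
  qed
  show ?thesis
    unfolding Z is_arg_min_linorder using Z_plex Z_ball bound by auto
qed

end
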